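(* Let $\mathcal{F}$ be an iterated function system on a compact metric space $\mathbb{X}$, let $A$ be a Conley attractor of $\mathcal{F}$, and let $\mathcal{N}$ be a neighborhood of $A$. Then there is an attractor block $Q$ for $A$ with respect to $\mathcal{F}$ such that $Q \subset \mathcal{N}$.
   Context: An iterated function system (IFS) $\mathcal{F} = (\mathbb{X}; f_1,\dots,f_N)$ on a metric space $\mathbb{X}$ is a finite collection of continuous functions $f_n : \mathbb{X}\to\mathbb{X}$, $n=1,\dots,N$. The same symbol denotes the map on subsets $\mathcal{F}(S) = \bigcup_{f\in\mathcal{F}} f(S)$, and $\mathcal{F}^k$ is its $k$-fold composition, with $\mathcal{F}^0(S)=S$. Closure and interior of $S$ are denoted $\overline{S}$ and $S^\circ$. The Hausdorff distance is $d_{\mathbb{H}}(S,T)=\inf\{r>0 : S\subset T_r \text{ and } T\subset S_r\}$, where $S_r$ is the set of points at distance less than $r$ from some point of $S$. A compact set $A\subset\mathbb{X}$ is a Conley attractor of $\mathcal{F}$ if there is an open set $U$ with $A\subset U$ and $A=\lim_{k\to\infty}\mathcal{F}^k(\overline{U})$ in the Hausdorff metric. The empty set is allowed as a Conley attractor (with $U=\emptyset$; a sequence of sets converges to $\emptyset$ only if the sets are eventually empty). A set $Q\subset\mathbb{X}$ is an attractor block with respect to $\mathcal{F}$ if $\mathcal{F}(\overline{Q})\subset Q^\circ$. It is an attractor block for $A$ with respect to $\mathcal{F}$ if, in addition, $A=\bigcap_{k\ge 1}\mathcal{F}^k(\overline{Q})$ (the intersection is also the Hausdorff limit of $\mathcal{F}^k(\overline{Q})$).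 *)

theory Defs
  imports "HOL-Analysis.Analysis"
begin

text \<open>
  The ambient metric space is a type of class \<^class>\<open>metric_space\<close>. An iterated function
  system is the list of its functions; the empty list is admitted.
\<close>

type_synonym 'a ifs = "('a \<Rightarrow> 'a) list"

definition is_ifs :: "'a::metric_space ifs \<Rightarrow> bool" where
  "is_ifs F \<longleftrightarrow> (\<forall>f\<in>set F. continuous_on UNIV f)"

definition ifs_map :: "'a ifs \<Rightarrow> 'a set \<Rightarrow> 'a set" where
  "ifs_map F S = (\<Union>f\<in>set F. f ` S)"

definition thickening :: "real \<Rightarrow> 'a::metric_space set \<Rightarrow> 'a set" where
  "thickening r S = {x. \<exists>s\<in>S. dist x s < r}"

text \<open>
  The Hausdorff distance is extended-real valued, so that the infimum over the empty set
  is infinite. Hence the distance of a nonempty set to the empty set is \<open>\<infinity>\<close>, that of the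
  empty set to itself is \<open>0\<close>, and a sequence of sets converges to the empty set iff it is
  eventually empty.
\<close>

definition hausdorff_dist :: "'a::metric_space set \<Rightarrow> 'a set \<Rightarrow> ereal" where
  "hausdorff_dist S T =
     Inf {ereal r | r. r > 0 \<and> S \<subseteq> thickening r T \<and> T \<subseteq> thickening r S}"

definition hausdorff_converges :: "(nat \<Rightarrow> 'a::metric_space set) \<Rightarrow> 'a set \<Rightarrow> bool" where
  "hausdorff_converges S A \<longleftrightarrow> (\<lambda>k. hausdorff_dist (S k) A) \<longlonglongrightarrow> 0"

definition conley_attractor :: "'a::metric_space ifs \<Rightarrow> 'a set \<Rightarrow> bool" where
  "conley_attractor F A \<longleftrightarrow> compact A \<and>
     (\<exists>U. open U \<and> A \<subseteq> U \<and>
          hausdorff_converges (\<lambda>k. (ifs_map F ^^ k) (closure U)) A)"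

definition attractor_block :: "'a::metric_space ifs \<Rightarrow> 'a set \<Rightarrow> bool" where
  "attractor_block F Q \<longleftrightarrow> ifs_map F (closure Q) \<subseteq> interior Q"

definition attractor_block_for :: "'a::metric_space ifs \<Rightarrow> 'a set \<Rightarrow> 'a set \<Rightarrow> bool" where
  "attractor_block_for F A Q \<longleftrightarrow> attractor_block F Q \<and>
     A = (\<Inter>k\<in>{1..}. (ifs_map F ^^ k) (closure Q))"

end

theory Submission
  imports Defs
begin

text \<open>
  Choose radii $2e = r_0 > r_1 > \dots > e$ such that the $2e$-thickening of $A$ lies in the basin
  $U$ and in $N$, and $m \ge 1$ such that $\mathcal{F}^m$ maps the closure of $U$ into the
  $e$-thickening of $A$. Let $Q$ be the open set of the points $x$ such that $\mathcal{F}^k(\{x\})$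
  lies in the $r_k$-thickening of $A$ for all $k < m$. For $x$ in the closure of $Q$, the set
  $\mathcal{F}^{k+1}(\{x\})$ lies in the closure of the $r_{k+1}$-thickening, hence in the
  $r_k$-thickening, if $k + 1 < m$, and in the $e$-thickening if $k + 1 = m$. So
  $\mathcal{F}(\{x\}) \subseteq Q$.
\<close>

lemma ifs_map_mono: "S \<subseteq> T \<Longrightarrow> ifs_map F S \<subseteq> ifs_map F T"
  by (auto simp: ifs_map_def)

lemma ifs_map_pow_mono: "S \<subseteq> T \<Longrightarrow> (ifs_map F ^^ k) S \<subseteq> (ifs_map F ^^ k) T"
  by (induction k) (simp_all add: ifs_map_mono)

text \<open>\<open>ifs_map F\<close> commutes with unions, so its iterates are determined by their
  values on singletons.\<close>

lemma ifs_map_pow_eq_UN: "(ifs_map F ^^ k) S = (\<Union>x\<in>S. (ifs_map F ^^ k) {x})"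
proof (induction k)
  case (Suc k)
  have "(ifs_map F ^^ Suc k) S = ifs_map F (\<Union>x\<in>S. (ifs_map F ^^ k) {x})"
    using Suc by simp
  also have "\<dots> = (\<Union>x\<in>S. (ifs_map F ^^ Suc k) {x})"
    by (auto simp: ifs_map_def)
  finally show ?case .
qed auto

text \<open>Splitting off the function applied first, not the last one, turns a condition on the
  iterates at \<open>x\<close> into conditions on shorter iterates at the points \<open>f x\<close>.
  These are preimages under the functions of \<open>F\<close>.\<close>

lemma ifs_map_pow_Suc_singleton_subset_iff:
  "(ifs_map F ^^ Suc k) {x} \<subseteq> V \<longleftrightarrow> (\<forall>f\<in>set F. (ifs_map F ^^ k) {f x} \<subseteq> V)"
proof -
  have "(ifs_map F ^^ Suc k) {x} = (ifs_map F ^^ k) (\<Union>f\<in>set F. {f x})"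
    by (simp add: funpow_swap1 ifs_map_def)
  also have "\<dots> = (\<Union>f\<in>set F. (ifs_map F ^^ k) {f x})"
    by (subst ifs_map_pow_eq_UN) auto
  finally show ?thesis
    by auto
qed

text \<open>In the induction step the set is an intersection of preimages of an open set, one for
  each of the finitely many functions.\<close>

lemma open_ifs_map_pow_subset:
  assumes "is_ifs F" "open V"
  shows "open {x. (ifs_map F ^^ k) {x} \<subseteq> V}"
proof (induction k)
  case (Suc k)
  have "{x. (ifs_map F ^^ Suc k) {x} \<subseteq> V} =
      (\<Inter>f\<in>set F. f -` {x. (ifs_map F ^^ k) {x} \<subseteq> V})"
    unfolding ifs_map_pow_Suc_singleton_subset_iff by auto
  moreover have "open (f -` {x. (ifs_map F ^^ k) {x} \<subseteq> V})" if "f \<in> set F" for f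
    using that assms(1) Suc by (intro open_vimage) (auto simp: is_ifs_def)
  ultimately show ?case
    by (simp add: open_INT)
qed (use assms in simp)

lemma closed_ifs_map_pow_subset:
  assumes "is_ifs F" "closed V"
  shows "closed {x. (ifs_map F ^^ k) {x} \<subseteq> V}"
proof (induction k)
  case (Suc k)
  have "{x. (ifs_map F ^^ Suc k) {x} \<subseteq> V} =
      (\<Inter>f\<in>set F. f -` {x. (ifs_map F ^^ k) {x} \<subseteq> V})"
    unfolding ifs_map_pow_Suc_singleton_subset_iff by auto
  moreover have "closed (f -` {x. (ifs_map F ^^ k) {x} \<subseteq> V})" if "f \<in> set F" for f
    using that assms(1) Suc by (intro closed_vimage) (auto simp: is_ifs_def)
  ultimately show ?case
    by (simp add: closed_INT)
qed (use assms in simp)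

lemma thickening_eq_UN_ball: "thickening r S = (\<Union>s\<in>S. ball s r)"
  by (auto simp: thickening_def dist_commute)

lemma open_thickening: "open (thickening r S)"
  by (auto simp: thickening_eq_UN_ball)

lemma thickening_mono: "r \<le> r' \<Longrightarrow> thickening r S \<subseteq> thickening r' S"
  by (force simp: thickening_def)

lemma subset_thickening: "r > 0 \<Longrightarrow> S \<subseteq> thickening r S"
  by (force simp: thickening_def)

lemma closure_thickening_subset:
  assumes "r < r'"
  shows "closure (thickening r S) \<subseteq> thickening r' S"
proof
  fix x assume "x \<in> closure (thickening r S)"
  moreover have "r' - r > 0"
    using assms by simp
  ultimately obtain y where "y \<in> thickening r S" "dist y x < r' - r"
    unfolding closure_approachable by blast
  then obtain s where "s \<in> S" "dist y s < r" "dist y x < r' - r"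
    by (auto simp: thickening_def)
  then show "x \<in> thickening r' S"
    using dist_triangle[of x s y] by (force simp: thickening_def dist_commute)
qed

lemma closed_mem_iff_thickening:
  assumes "closed S"
  shows "x \<in> S \<longleftrightarrow> (\<forall>e>0. x \<in> thickening e S)"
proof -
  have "x \<in> S \<longleftrightarrow> x \<in> closure S"
    using assms by simp
  then show ?thesis
    by (auto simp: closure_approachable thickening_def dist_commute)
qed

text \<open>An infimum below \<open>e\<close> yields an admissible radius below \<open>e\<close>.
  For \<open>A = {}\<close> this says that the sets are eventually empty, since thickenings of the
  empty set are empty.\<close>

lemma hausdorff_converges_eventually:
  assumes "hausdorff_converges S A" "e > 0"
  shows "\<forall>\<^sub>F k in sequentially. S k \<subseteq> thickening e A \<and> A \<subseteq> thickening e (S k)"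
proof -
  have "\<forall>\<^sub>F k in sequentially. hausdorff_dist (S k) A < ereal e"
    using assms unfolding hausdorff_converges_def by (intro order_tendstoD) auto
  then show ?thesis
  proof eventually_elim
    case (elim k)
    then obtain r where "r < e" "S k \<subseteq> thickening r A" "A \<subseteq> thickening r (S k)"
      by (auto simp: hausdorff_dist_def Inf_less_iff)
    then show ?case
      using thickening_mono[of r e] by (meson less_imp_le order_trans)
  qed
qed

text \<open>Write S_k for the iterates. S_(k+1) is the image of S_k, and uniform continuity allows
  passing to the limit on both sides. The limits \<open>A\<close> and \<open>ifs_map F A\<close> are
  closed, so agreement up to every \<open>e\<close> is equality.\<close>

lemma hausdorff_limit_ifs_map_invariant:
  fixes F :: "'a::metric_space ifs"
  assumes X: "compact (UNIV :: 'a set)" and F: "is_ifs F" and A: "compact A"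
    and lim: "hausdorff_converges (\<lambda>k. (ifs_map F ^^ k) S) A"
  shows "ifs_map F A = A"
proof -
  have unif: "\<exists>d>0. \<forall>f\<in>set F. \<forall>x y. dist x y < d \<longrightarrow> dist (f x) (f y) < e" if "e > 0" for e
  proof -
    have "\<exists>d>0. \<forall>x y. dist x y < d \<longrightarrow> dist (f x) (f y) < e" if "f \<in> set F" for f
      using compact_uniformly_continuous[OF _ X, of f] F that \<open>e > 0\<close>
      by (auto simp: is_ifs_def uniformly_continuous_on_def dist_commute)
    then obtain d where d: "\<And>f. f \<in> set F \<Longrightarrow> d f > (0::real)"
      "\<And>f x y. f \<in> set F \<Longrightarrow> dist x y < d f \<Longrightarrow> dist (f x) (f y) < e"
      by metis
    show ?thesis
      \<comment> \<open>The inserted \<open>1\<close> keeps the set nonempty when \<open>F\<close>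
        is the empty list.\<close>
      by (rule exI[of _ "Min (insert 1 (d ` set F))"]) (use d in auto)
  qed
  \<comment> \<open>Two consecutive iterates are needed at once: the first within the modulus of
    continuity \<open>d\<close>, the second within the target error \<open>e\<close>.\<close>
  have ev: "\<exists>k. (ifs_map F ^^ k) S \<subseteq> thickening d A \<and> A \<subseteq> thickening d ((ifs_map F ^^ k) S) \<and>
      (ifs_map F ^^ Suc k) S \<subseteq> thickening e A \<and> A \<subseteq> thickening e ((ifs_map F ^^ Suc k) S)"
    if "d > 0" "e > 0" for d e
  proof -
    note hausdorff_converges_eventually[OF lim \<open>d > 0\<close>]
    moreover have "\<forall>\<^sub>F k in sequentially. (ifs_map F ^^ Suc k) S \<subseteq> thickening e A \<and>
        A \<subseteq> thickening e ((ifs_map F ^^ Suc k) S)"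
      using hausdorff_converges_eventually[OF lim \<open>e > 0\<close>] by (subst eventually_sequentially_Suc)
    ultimately show ?thesis
      using eventually_happens'[OF sequentially_bot eventually_conj] by fastforce
  qed
  have "compact (ifs_map F A)"
    unfolding ifs_map_def using F A
    by (intro compact_UN compact_continuous_image)
      (auto simp: is_ifs_def intro: continuous_on_subset)
  then have closed_FA: "closed (ifs_map F A)"
    by (rule compact_imp_closed)
  show ?thesis
  proof (intro equalityI subsetI)
    fix b assume "b \<in> ifs_map F A"
    then obtain f a where fa: "f \<in> set F" "a \<in> A" "b = f a"
      by (auto simp: ifs_map_def)
    \<comment> \<open>Replace \<open>a\<close> by a nearby point \<open>s\<close> of the
      \<open>k\<close>-th iterate; then \<open>f s\<close> is near \<open>b\<close> and, lying in
      the next iterate, also near \<open>A\<close>.\<close>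
    have "b \<in> thickening e A" if "e > 0" for e
    proof -
      obtain d where d: "d > 0" "\<And>f x y. f \<in> set F \<Longrightarrow> dist x y < d \<Longrightarrow> dist (f x) (f y) < e / 2"
        using unif[of "e / 2"] \<open>e > 0\<close> by auto
      obtain k where k: "A \<subseteq> thickening d ((ifs_map F ^^ k) S)"
        "(ifs_map F ^^ Suc k) S \<subseteq> thickening (e / 2) A"
        using ev[of d "e / 2"] d \<open>e > 0\<close> by auto
      obtain s where s: "s \<in> (ifs_map F ^^ k) S" "dist a s < d"
        using k(1) fa by (auto simp: thickening_def)
      have "f s \<in> (ifs_map F ^^ Suc k) S"
        using s fa by (auto simp: ifs_map_def)
      then obtain a' where a': "a' \<in> A" "dist (f s) a' < e / 2"
        using k(2) by (auto simp: thickening_def)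
      have "dist b a' < e"
        using d(2)[OF fa(1) s(2)] a' dist_triangle[of b a' "f s"] fa by simp
      then show ?thesis
        using a' by (auto simp: thickening_def)
    qed
    then show "b \<in> A"
      using closed_mem_iff_thickening[OF compact_imp_closed[OF A]] by blast
  next
    fix a assume "a \<in> A"
    \<comment> \<open>Conversely, \<open>a\<close> is near some \<open>f s\<close> with
      \<open>s\<close> in the \<open>k\<close>-th iterate, and \<open>s\<close> is near some point
      of \<open>A\<close>.\<close>
    have "a \<in> thickening e (ifs_map F A)" if "e > 0" for e
    proof -
      obtain d where d: "d > 0" "\<And>f x y. f \<in> set F \<Longrightarrow> dist x y < d \<Longrightarrow> dist (f x) (f y) < e / 2"
        using unif[of "e / 2"] \<open>e > 0\<close> by auto
      obtain k where k: "(ifs_map F ^^ k) S \<subseteq> thickening d A"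
        "A \<subseteq> thickening (e / 2) ((ifs_map F ^^ Suc k) S)"
        using ev[of d "e / 2"] d \<open>e > 0\<close> by auto
      obtain t where t: "t \<in> (ifs_map F ^^ Suc k) S" "dist a t < e / 2"
        using k(2) \<open>a \<in> A\<close> unfolding thickening_def by blast
      then obtain f s where fs: "f \<in> set F" "s \<in> (ifs_map F ^^ k) S" "t = f s"
        by (auto simp: ifs_map_def)
      obtain a' where a': "a' \<in> A" "dist s a' < d"
        using k(1) fs by (auto simp: thickening_def)
      have "dist a (f a') < e"
        using d(2)[OF fs(1) a'(2)] t fs dist_triangle[of a "f a'" t] by simp
      then show ?thesis
        using a' fs by (auto simp: thickening_def ifs_map_def)
    qed
    then show "a \<in> ifs_map F A"
      using closed_mem_iff_thickening[OF closed_FA] by blast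
  qed
qed

theorem theorem3p4:
  fixes F :: "'a::metric_space ifs" and A N :: "'a set"
  assumes "compact (UNIV :: 'a set)"
    and "is_ifs F"
    and "conley_attractor F A"
    and "A \<subseteq> interior N"
  shows "\<exists>Q. attractor_block_for F A Q \<and> Q \<subseteq> N"
proof -
  obtain U where A: "compact A" and U: "open U" "A \<subseteq> U"
    and lim: "hausdorff_converges (\<lambda>k. (ifs_map F ^^ k) (closure U)) A"
    using assms(3) by (auto simp: conley_attractor_def)
  have inv: "ifs_map F A = A"
    by (rule hausdorff_limit_ifs_map_invariant[OF assms(1,2) A lim])
  have inv_pow: "(ifs_map F ^^ k) A = A" for k
    by (induction k) (simp_all add: inv)
  obtain r where r: "r > 0" "thickening r A \<subseteq> U \<inter> interior N"
    unfolding thickening_eq_UN_ball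
    using compact_subset_open_imp_ball_epsilon_subset[OF A, of "U \<inter> interior N"] U assms(4)
    by (metis Int_subset_iff open_Int open_interior)
  obtain e where e: "e > 0" "thickening (2 * e) A \<subseteq> U \<inter> interior N"
    using r by (intro that[of "r / 2"]) simp_all
  \<comment> \<open>These radii decrease strictly from \<open>2 * e\<close> and stay above
    \<open>e\<close>; the strict decrease leaves room for the closure in
    \<open>V_step\<close>.\<close>
  define V where "V k = thickening (e + e / real (Suc k)) A" for k
  have V0: "V 0 \<subseteq> U \<inter> interior N"
    using e(2) by (simp add: V_def)
  have V_open: "open (V k)" for k
    by (simp add: V_def open_thickening)
  have V_ge: "thickening e A \<subseteq> V k" for k
    unfolding V_def using e(1) by (intro thickening_mono) simp
  have V_step: "closure (V (Suc k)) \<subseteq> V k" for k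
    unfolding V_def using e(1) by (intro closure_thickening_subset) (simp add: frac_less2)
  obtain n where n_ge: "\<And>k. k \<ge> n \<Longrightarrow> (ifs_map F ^^ k) (closure U) \<subseteq> thickening e A"
    using hausdorff_converges_eventually[OF lim e(1)] by (auto simp: eventually_sequentially)
  \<comment> \<open>\<open>Suc n\<close> serves as the exponent m. Being positive, it ensures that
    index 0 is among the conditions defining \<open>Q\<close>, whence \<open>Q\<close> lies in
    \<open>V 0\<close>.\<close>
  have n: "(ifs_map F ^^ Suc n) (closure U) \<subseteq> thickening e A"
    by (rule n_ge) simp
  define Q where "Q = (\<Inter>k\<in>{..n}. {x. (ifs_map F ^^ k) {x} \<subseteq> V k})"
  have "open Q"
    unfolding Q_def using assms(2) V_open by (intro open_INT) (auto intro: open_ifs_map_pow_subset)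
  have "Q \<subseteq> V 0"
    unfolding Q_def by force
  then have "Q \<subseteq> N" "closure Q \<subseteq> closure U"
    using V0 interior_subset[of N] by (blast, intro closure_mono, blast)
  have "A \<subseteq> Q"
  proof
    fix x assume "x \<in> A"
    then have "(ifs_map F ^^ k) {x} \<subseteq> V k" for k
      using ifs_map_pow_mono[of "{x}" A k F] inv_pow[of k] subset_thickening[OF e(1), of A] V_ge[of k]
      by auto
    then show "x \<in> Q"
      by (simp add: Q_def)
  qed
  \<comment> \<open>Weakening \<open>V k\<close> to its closure makes each condition defining
    \<open>Q\<close> closed, so it persists on \<open>closure Q\<close>.\<close>
  have closure_Q: "(ifs_map F ^^ k) {x} \<subseteq> closure (V k)" if "x \<in> closure Q" "k \<le> n" for x k
  proof -
    have "Q \<subseteq> {x. (ifs_map F ^^ k) {x} \<subseteq> closure (V k)}"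
      using \<open>k \<le> n\<close> closure_subset[of "V k"] unfolding Q_def by blast
    then have "closure Q \<subseteq> {x. (ifs_map F ^^ k) {x} \<subseteq> closure (V k)}"
      by (rule closure_minimal) (simp add: closed_ifs_map_pow_subset assms(2))
    then show ?thesis
      using that by blast
  qed
  have "ifs_map F (closure Q) \<subseteq> Q"
  proof
    fix y assume "y \<in> ifs_map F (closure Q)"
    then obtain f x where fx: "f \<in> set F" "x \<in> closure Q" "y = f x"
      by (auto simp: ifs_map_def)
    have "(ifs_map F ^^ k) {y} \<subseteq> V k" if "k \<le> n" for k
    proof -
      have "(ifs_map F ^^ Suc k) {x} \<subseteq> V k"
      proof (cases "k = n")
        case True
        \<comment> \<open>No condition in \<open>Q\<close> concerns the exponent
          \<open>Suc n\<close>; here the choice of \<open>n\<close> applies, because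
          \<open>closure Q\<close> lies in \<open>closure U\<close>.\<close>
        have "(ifs_map F ^^ Suc n) {x} \<subseteq> (ifs_map F ^^ Suc n) (closure U)"
          using fx \<open>closure Q \<subseteq> closure U\<close> by (intro ifs_map_pow_mono) blast
        then show ?thesis
          using n V_ge[of n] True by blast
      next
        case False
        then show ?thesis
          using closure_Q[of x "Suc k"] fx that V_step[of k] by auto
      qed
      then show ?thesis
        using fx unfolding ifs_map_pow_Suc_singleton_subset_iff by blast
    qed
    then show "y \<in> Q"
      by (simp add: Q_def)
  qed
  then have block: "attractor_block F Q"
    using \<open>open Q\<close> by (simp add: attractor_block_def interior_open)
  \<comment> \<open>The iterates of \<open>closure Q\<close> are squeezed between the invariant set
    \<open>A\<close> and the iterates of \<open>closure U\<close>, which converge to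
    \<open>A\<close>.\<close>
  have "A \<subseteq> (ifs_map F ^^ k) (closure Q)" for k
    using ifs_map_pow_mono[of A "closure Q" k F] \<open>A \<subseteq> Q\<close> closure_subset[of Q] inv_pow[of k] by auto
  moreover have "x \<in> A" if x: "\<And>k. k \<ge> 1 \<Longrightarrow> x \<in> (ifs_map F ^^ k) (closure Q)" for x
  proof -
    have "x \<in> thickening d A" if "d > 0" for d
    proof -
      obtain l where "\<And>k. k \<ge> l \<Longrightarrow> (ifs_map F ^^ k) (closure U) \<subseteq> thickening d A"
        using hausdorff_converges_eventually[OF lim \<open>d > 0\<close>] by (auto simp: eventually_sequentially)
      then have "(ifs_map F ^^ Suc l) (closure U) \<subseteq> thickening d A"
        using le_Suc_eq by blast
      then show ?thesis
        using x[of "Suc l"] ifs_map_pow_mono[OF \<open>closure Q \<subseteq> closure U\<close>, of "Suc l" F] by auto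
    qed
    then show ?thesis
      using closed_mem_iff_thickening[OF compact_imp_closed[OF A]] by blast
  qed
  ultimately have "A = (\<Inter>k\<in>{1..}. (ifs_map F ^^ k) (closure Q))"
    by auto
  then show ?thesis
    using block \<open>Q \<subseteq> N\<close> unfolding attractor_block_for_def by blast
qed

end
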